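(* Let $f\in\mathcal{G}_{sh}$ with $f(z)=z+\sum_{n=2}^{\infty}a_nz^n$. Then $$\left|H_{3,1}(f)\right|\le\frac14.$$
   Context: $\mathbb{D}=\{z\in\mathbb{C}:|z|<1\}$. $\mathcal{A}$ is the class of analytic functions on $\mathbb{D}$ of the form $f(z)=z+\sum_{n=2}^\infty a_nz^n$. Subordination: $f_1\prec f_2$ means there is a Schwarz function $\omega$ (analytic on $\mathbb{D}$, $|\omega(z)|\le|z|$) with $f_1(z)=f_2(\omega(z))$ for $z\in\mathbb{D}$. The class $\mathcal{G}_{sh}$ is $$\mathcal{G}_{sh}=\left\{f\in\mathcal{A}:\frac{zf'(z)}{f(z)}-1\prec\sinh(z)\right\}.$$ The third Hankel determinant of $f$ is $$H_{3,1}(f)=a_3(a_2a_4-a_3^2)-a_4(a_4-a_2a_3)+a_5(a_3-a_2^2).$$ *)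

theory Defs
  imports "HOL-Complex_Analysis.Complex_Analysis"
begin

abbreviation unit_disc :: "complex set" where
  "unit_disc \<equiv> ball 0 1"

definition class_A :: "(complex \<Rightarrow> complex) set" where
  "class_A = {f. f holomorphic_on unit_disc \<and>
     (\<exists>a. \<forall>z\<in>unit_disc. (\<lambda>n. a (n + 2) * z ^ (n + 2)) sums (f z - z))}"

definition schwarz_function :: "(complex \<Rightarrow> complex) \<Rightarrow> bool" where
  "schwarz_function \<omega> \<longleftrightarrow>
     \<omega> holomorphic_on unit_disc \<and> (\<forall>z\<in>unit_disc. norm (\<omega> z) \<le> norm z)"

definition subordinate :: "(complex \<Rightarrow> complex) \<Rightarrow> (complex \<Rightarrow> complex) \<Rightarrow> bool"
    (infix "\<prec>\<^sub>s" 50) where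
  "f1 \<prec>\<^sub>s f2 \<longleftrightarrow> (\<exists>\<omega>. schwarz_function \<omega> \<and> (\<forall>z\<in>unit_disc. f1 z = f2 (\<omega> z)))"

text \<open>
  The quotient \<open>z f'(z) / f(z)\<close> has a removable singularity at the origin, where its value is
  \<open>1\<close> for \<open>f\<close> in \<^term>\<open>class_A\<close>.  This value is given explicitly,
  since division by zero yields \<open>0\<close>.
\<close>
definition zf'_over_f :: "(complex \<Rightarrow> complex) \<Rightarrow> complex \<Rightarrow> complex" where
  "zf'_over_f f z = (if z = 0 then 1 else z * deriv f z / f z)"

text \<open>
  The condition that \<open>f\<close> does not vanish away from the origin says that the quotient is
  a genuine one on the whole disc; it is implicit in writing a subordination for it.
\<close>
definition G_sh :: "(complex \<Rightarrow> complex) set" where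
  "G_sh = {f \<in> class_A. (\<forall>z\<in>unit_disc - {0}. f z \<noteq> 0) \<and>
     (\<lambda>z. zf'_over_f f z - 1) \<prec>\<^sub>s sinh}"

definition taylor_coeff :: "(complex \<Rightarrow> complex) \<Rightarrow> nat \<Rightarrow> complex" where
  "taylor_coeff f n = fps_nth (fps_expansion f 0) n"

definition hankel_3_1 :: "(complex \<Rightarrow> complex) \<Rightarrow> complex" where
  "hankel_3_1 f = (let a = taylor_coeff f in
     a 3 * (a 2 * a 4 - (a 3)\<^sup>2) - a 4 * (a 4 - a 2 * a 3) + a 5 * (a 3 - (a 2)\<^sup>2))"

lemma taylor_coeff_unique:
  assumes "\<And>z. z \<in> unit_disc \<Longrightarrow> (\<lambda>n. a n * z ^ n) sums f z"
  shows "taylor_coeff f n = a n"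
proof -
  have "f has_fps_expansion Abs_fps a"
  proof (rule has_fps_expansionI)
    have "\<forall>\<^sub>F z in nhds 0. z \<in> unit_disc"
      by (intro eventually_nhds_in_open) auto
    then show "\<forall>\<^sub>F z in nhds 0. (\<lambda>n. fps_nth (Abs_fps a) n * z ^ n) sums f z"
      by eventually_elim (use assms in auto)
  qed
  then show ?thesis
    using fps_nth_fps_expansion[of f "Abs_fps a" n]
    by (simp add: taylor_coeff_def fps_expansion_def)
qed

lemma class_A_sums:
  assumes "f \<in> class_A" "z \<in> unit_disc"
  shows "(\<lambda>n. taylor_coeff f n * z ^ n) sums f z"
  using assms holomorphic_power_series[of f 0 1 z]
  by (simp add: class_A_def taylor_coeff_def fps_expansion_def)

lemma class_A_taylor_coeff:
  assumes "f \<in> class_A"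
  shows "taylor_coeff f 0 = 0" "taylor_coeff f 1 = 1"
proof -
  obtain a where a: "\<And>z. z \<in> unit_disc \<Longrightarrow> (\<lambda>n. a (n + 2) * z ^ (n + 2)) sums (f z - z)"
    using assms unfolding class_A_def by blast
  define b where "b n = (if n = 0 then 0 else if n = 1 then 1 else a n)" for n :: nat
  have "(\<lambda>n. b n * z ^ n) sums f z" if "z \<in> unit_disc" for z
  proof -
    have "(\<lambda>n. b (n + 2) * z ^ (n + 2)) sums (f z - (\<Sum>i<2. b i * z ^ i))"
      using a[OF that] by (simp add: b_def numeral_2_eq_2)
    then show ?thesis
      by (subst (asm) sums_iff_shift) simp
  qed
  from taylor_coeff_unique[of b f, OF this]
  show "taylor_coeff f 0 = 0" "taylor_coeff f 1 = 1"
    by (auto simp: b_def)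
qed

end

theory Submission
  imports Defs
begin

text \<open>
  Write \<open>z f'(z) / f(z) = 1 + sinh (\<omega>(z))\<close> with a Schwarz function \<open>\<omega>\<close> whose Taylor coefficients
  are \<open>c\<^sub>k\<close>.  Comparing coefficients in \<open>z f' = f \<cdot> (1 + sinh \<circ> \<omega>)\<close> expresses the Hankel determinant
  as a polynomial in \<open>c\<^sub>1, \<dots>, c\<^sub>4\<close>, in which much cancels.  Its small coefficients and
  \<open>\<bar>c\<^sub>k\<bar> \<le> 1\<close> bound it by a quadratic form in \<open>\<bar>c\<^sub>1\<bar>, \<dots>, \<bar>c\<^sub>4\<bar>\<close> that is at most
  \<open>(\<bar>c\<^sub>1\<bar>\<^sup>2 + \<dots> + \<bar>c\<^sub>4\<bar>\<^sup>2) / 4\<close>, and Bessel's inequality \<open>\<Sum> \<bar>c\<^sub>k\<bar>\<^sup>2 \<le> 1\<close>, valid because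
  \<open>\<omega>\<close> is bounded by \<open>1\<close>, finishes the proof.  Bessel's inequality comes from the mean of
  \<open>\<bar>\<omega> - p\<bar>\<^sup>2 \<ge> 0\<close> over a circle, where \<open>p\<close> is a Taylor polynomial of \<open>\<omega>\<close>.
\<close>

section \<open>Bessel's inequality for Taylor coefficients\<close>

text \<open>Cauchy's coefficient formula on the circle of radius \<open>r\<close>. Conjugation
  inverts \<open>cis\<close>, which gives the kernel a form that matches the conjugate of a
  polynomial.\<close>

lemma taylor_coeff_has_integral:
  assumes "f holomorphic_on unit_disc" "0 < r" "r < 1"
  shows "((\<lambda>t. f (of_real r * cis (2 * pi * t)) * cnj (cis (2 * pi * t)) ^ k)
           has_integral taylor_coeff f k * of_real r ^ k) {0..1}"
proof -
  have "continuous_on (cball 0 r) f" "f holomorphic_on ball 0 r"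
    using assms
    by (auto intro!: holomorphic_on_imp_continuous_on intro: holomorphic_on_subset)
  from Cauchy_has_contour_integral_higher_derivative_circlepath[OF this, of 0 k]
  have "((\<lambda>u. f u / u ^ Suc k) has_contour_integral 2 * pi * \<i> * taylor_coeff f k) (circlepath 0 r)"
    using assms by (simp add: taylor_coeff_def fps_expansion_def)
  then have "((\<lambda>t. f (of_real r * cis (2 * pi * t)) / (of_real r * cis (2 * pi * t)) ^ Suc k
               * (2 * pi * \<i> * of_real r * cis (2 * pi * t)))
             has_integral 2 * pi * \<i> * taylor_coeff f k) {0..1}"
    unfolding has_contour_integral_def
    by (rule has_integral_eq[rotated], subst vector_derivative_circlepath01)
       (simp_all add: circlepath cis_conv_exp mult_ac)
  from has_integral_mult_right[OF this, of "of_real r ^ k / (2 * pi * \<i>)"]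
  show ?thesis
    using assms
    by - (rule has_integral_eq[rotated], auto simp: field_simps cis_cnj simp flip: cis_inverse)
qed

text \<open>The Taylor polynomial \<open>p\<close> has the same mean product with \<open>f\<close>
  as with itself, namely the sum \<open>S\<close>; hence 0 \<le> 1 - 2 \<open>S\<close> +
  \<open>S\<close>.\<close>

lemma sum_taylor_coeff_circle_le:
  assumes f: "f holomorphic_on unit_disc" "\<And>z. z \<in> unit_disc \<Longrightarrow> norm (f z) \<le> 1"
    and r: "0 < r" "r < 1"
  shows "(\<Sum>k\<le>n. (norm (taylor_coeff f k) * r ^ k)\<^sup>2) \<le> 1"
proof -
  define c where "c k = taylor_coeff f k" for k
  define p where "p = (\<lambda>z. \<Sum>k\<le>n. c k * z ^ k)"
  define S where "S = (\<Sum>k\<le>n. (norm (c k) * r ^ k)\<^sup>2)"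
  define w where "w t = of_real r * cis (2 * pi * t)" for t
  have p: "p holomorphic_on unit_disc"
    unfolding p_def by (intro holomorphic_intros)
  have coeff_p: "taylor_coeff p k = c k" if "k \<le> n" for k
  proof -
    have "(\<lambda>j. (if j \<le> n then c j else 0) * z ^ j) sums p z" for z
      unfolding p_def using sums_finite[of "{..n}" "\<lambda>j. (if j \<le> n then c j else 0) * z ^ j"]
      by simp
    from taylor_coeff_unique[OF this] show ?thesis
      using that by simp
  qed
  \<comment> \<open>Pairing with \<open>p\<close> sees only the coefficients of \<open>g\<close> up
    to \<open>n\<close>, so this serves both \<open>g = f\<close> and \<open>g = p\<close>.\<close>
  have mean: "((\<lambda>t. Re (g (w t) * cnj (p (w t)))) has_integral S) {0..1}"
    if g: "g holomorphic_on unit_disc" "\<And>k. k \<le> n \<Longrightarrow> taylor_coeff g k = c k" for g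
  proof -
    have "((\<lambda>t. \<Sum>k\<le>n. cnj (c k) * of_real r ^ k * (g (w t) * cnj (cis (2 * pi * t)) ^ k))
             has_integral (\<Sum>k\<le>n. cnj (c k) * of_real r ^ k * (c k * of_real r ^ k))) {0..1}"
    proof (intro has_integral_sum has_integral_mult_right)
      show "((\<lambda>t. g (w t) * cnj (cis (2 * pi * t)) ^ k) has_integral c k * of_real r ^ k) {0..1}"
        if "k \<in> {..n}" for k
        using taylor_coeff_has_integral[OF g(1) r, of k] g(2)[of k] that by (simp add: w_def)
    qed simp
    moreover have "(\<Sum>k\<le>n. cnj (c k) * of_real r ^ k * (g (w t) * cnj (cis (2 * pi * t)) ^ k))
        = g (w t) * cnj (p (w t))" for t
      by (simp add: p_def w_def sum_distrib_left power_mult_distrib mult_ac)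
    moreover have "cnj (c k) * c k = of_real (norm (c k)) * of_real (norm (c k))" for k
      using complex_norm_square[of "c k"] by (simp add: power2_eq_square mult.commute)
    then have "(\<Sum>k\<le>n. cnj (c k) * of_real r ^ k * (c k * of_real r ^ k)) = of_real S"
      unfolding S_def of_real_sum by (intro sum.cong refl) (simp add: power2_eq_square)
    ultimately have "((\<lambda>t. g (w t) * cnj (p (w t))) has_integral complex_of_real S) {0..1}"
      by simp
    from has_integral_linear[OF this bounded_linear_Re] show ?thesis
      by (simp add: o_def del: times_complex.sel)
  qed
  have "((\<lambda>t. 1 - 2 * Re (f (w t) * cnj (p (w t))) + Re (p (w t) * cnj (p (w t))))
          has_integral 1 - 2 * S + S) {0..1}"
    using has_integral_const_real[of "1::real" 0 1] mean[OF f(1)] mean[OF p coeff_p]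
    by (intro has_integral_add has_integral_diff has_integral_mult_right) (auto simp: c_def)
  \<comment> \<open>This dominates the squared norm of \<open>f - p\<close>, the term 1 standing in
    for the squared norm of \<open>f\<close>.\<close>
  moreover have "0 \<le> 1 - 2 * Re (f (w t) * cnj (p (w t))) + Re (p (w t) * cnj (p (w t)))" for t
  proof -
    have Re_cnj: "Re (z * cnj z) = (norm z)\<^sup>2" for z
      unfolding cmod_power2 by (simp add: power2_eq_square)
    have "norm (f (w t)) \<le> 1"
      using r by (intro f) (simp add: w_def norm_mult)
    then have "Re (f (w t) * cnj (f (w t))) \<le> 1"
      unfolding Re_cnj by (simp add: power_le_one)
    moreover have "0 \<le> Re ((f (w t) - p (w t)) * cnj (f (w t) - p (w t)))"
      unfolding Re_cnj by simp
    ultimately show ?thesis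
      by (simp add: algebra_simps)
  qed
  ultimately have "0 \<le> 1 - 2 * S + S"
    by (rule has_integral_nonneg)
  then show ?thesis
    by (simp add: S_def c_def)
qed

text \<open>The finite sum is continuous in \<open>r\<close>, so the bound on circles survives
  \<open>r\<close> tending to 1 from the left.\<close>

lemma sum_taylor_coeff_le:
  assumes "f holomorphic_on unit_disc" "\<And>z. z \<in> unit_disc \<Longrightarrow> norm (f z) \<le> 1"
  shows "(\<Sum>k\<le>n. (norm (taylor_coeff f k))\<^sup>2) \<le> 1"
proof (rule tendsto_upperbound)
  show "((\<lambda>r. \<Sum>k\<le>n. (norm (taylor_coeff f k) * r ^ k)\<^sup>2) \<longlongrightarrow>
          (\<Sum>k\<le>n. (norm (taylor_coeff f k))\<^sup>2)) (at_left (1::real))"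
    by (rule tendsto_eq_intros refl | simp)+
  have "\<forall>\<^sub>F r in at_left (1::real). r \<in> {0<..<1}"
    by (rule eventually_at_left_real) simp
  then show "\<forall>\<^sub>F r in at_left 1. (\<Sum>k\<le>n. (norm (taylor_coeff f k) * r ^ k)\<^sup>2) \<le> 1"
    by eventually_elim (use sum_taylor_coeff_circle_le[OF assms] in auto)
qed simp

section \<open>The Hankel determinant in Schwarz coefficients\<close>

lemma has_fps_expansion_sinh:
  "sinh has_fps_expansion Abs_fps (\<lambda>n. if odd n then 1 / fact n else (0::complex))"
proof -
  have "(\<lambda>z. (exp (1 * z) - exp (- 1 * z)) * (1 / 2)) has_fps_expansion
          (fps_exp 1 - fps_exp (- 1)) * fps_const (1 / 2 :: complex)"
    by (intro fps_expansion_intros)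
  moreover have "(\<lambda>z. (exp (1 * z) - exp (- 1 * z)) * (1 / 2)) = (sinh :: complex \<Rightarrow> _)"
    by (auto simp: sinh_field_def)
  moreover have "(fps_exp 1 - fps_exp (- 1)) * fps_const (1 / 2) =
      Abs_fps (\<lambda>n. if odd n then 1 / fact n else (0::complex))"
    by (rule fps_ext) (auto simp: fps_mult_right_const_nth)
  ultimately show ?thesis by metis
qed

text \<open>Formal power series turn the differential equation into a recursion for the coefficients
  of \<open>f\<close>. The conclusion exposes \<open>\<omega>\<close> so that Bessel's inequality
  can be applied to it.\<close>

lemma hankel_3_1_eq:
  assumes "f \<in> G_sh"
  obtains \<omega> where "schwarz_function \<omega>"
    "hankel_3_1 f = (let c = taylor_coeff \<omega> in
       - (c 3)\<^sup>2 / 9 + (c 2 - (c 1)\<^sup>2) * c 4 / 8 + c 1 * c 2 * c 3 / 6 + c 1 ^ 3 * c 3 / 54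
       - c 2 ^ 3 / 16 - c 1 ^ 4 * c 2 / 72 - c 1 ^ 6 / 1296)"
proof -
  from assms have f: "f \<in> class_A" and nz: "\<And>z. z \<in> unit_disc - {0} \<Longrightarrow> f z \<noteq> 0"
    by (auto simp: G_sh_def)
  from assms obtain \<omega> where \<omega>: "schwarz_function \<omega>"
    and eq: "\<And>z. z \<in> unit_disc \<Longrightarrow> zf'_over_f f z - 1 = sinh (\<omega> z)"
    by (auto simp: G_sh_def subordinate_def)
  define F where "F = fps_expansion f 0"
  define W where "W = fps_expansion \<omega> 0"
  define S where "S = Abs_fps (\<lambda>n. if odd n then 1 / fact n else (0::complex))"
  have F: "f has_fps_expansion F"
    unfolding F_def using f
    by (intro has_fps_expansion_fps_expansion[of unit_disc]) (auto simp: class_A_def)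
  have W: "\<omega> has_fps_expansion W"
    unfolding W_def using \<omega>
    by (intro has_fps_expansion_fps_expansion[of unit_disc]) (auto simp: schwarz_function_def)
  \<comment> \<open>A vanishing constant term is what makes the composition \<open>S oo W\<close>
    represent \<open>sinh \<circ> \<omega>\<close>.\<close>
  have W0: "fps_nth W 0 = 0"
  proof -
    have "norm (\<omega> 0) \<le> norm (0 :: complex)"
      using \<omega> unfolding schwarz_function_def by (metis centre_in_ball zero_less_one)
    then show ?thesis
      by (simp add: W_def fps_expansion_def)
  qed
  have lhs: "(\<lambda>z. z * deriv f z) has_fps_expansion fps_X * fps_deriv F"
    by (intro fps_expansion_intros F)
  have rhs: "(\<lambda>z. f z * (1 + (sinh \<circ> \<omega>) z)) has_fps_expansion F * (1 + (S oo W))"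
    unfolding S_def by (intro fps_expansion_intros F W W0 has_fps_expansion_sinh)
  \<comment> \<open>At the origin both sides vanish because \<open>f 0 = 0\<close>; elsewhere
    \<open>f z\<close> is nonzero and the quotient can be cleared.\<close>
  have "f z * (1 + (sinh \<circ> \<omega>) z) = z * deriv f z" if "z \<in> unit_disc" for z
  proof (cases "z = 0")
    case True
    then show ?thesis
      using has_fps_expansion_imp_0_eq_fps_nth_0[OF F] class_A_taylor_coeff(1)[OF f]
      by (simp add: taylor_coeff_def F_def)
  next
    case False
    then show ?thesis
      using eq[OF that] nz[of z] that by (simp add: zf'_over_f_def field_simps)
  qed
  then have "\<forall>\<^sub>F z in nhds 0. f z * (1 + (sinh \<circ> \<omega>) z) = z * deriv f z"
    using eventually_nhds_in_open[of unit_disc "0::complex"] by (auto elim!: eventually_mono)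
  from has_fps_expansion_cong[OF this refl] rhs
  have "(\<lambda>z. z * deriv f z) has_fps_expansion F * (1 + (S oo W))"
    by simp
  from fps_expansion_unique_complex[OF lhs this]
  have ode: "fps_X * fps_deriv F = F * (1 + (S oo W))" .
  define a where "a = taylor_coeff f"
  define c where "c = taylor_coeff \<omega>"
  have Fn: "fps_nth F n = a n" and Wn: "fps_nth W n = c n" for n
    by (simp_all add: a_def c_def F_def W_def taylor_coeff_def)
  have [simp]: "a 0 = 0" "a (Suc 0) = 1" "c 0 = 0"
    using class_A_taylor_coeff[OF f] W0 by (simp_all add: a_def flip: Wn)
  have [simp]: "fps_nth S n = (if odd n then 1 / fact n else 0)" for n
    by (simp add: S_def)
  \<comment> \<open>As \<open>sinh\<close> is odd and \<open>W\<close> starts in degree 1, only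
    \<open>W\<close> and \<open>W ^ 3\<close> contribute up to degree 4.\<close>
  have W3: "fps_nth (W ^ 3) 3 = c 1 ^ 3" "fps_nth (W ^ 3) 4 = 3 * (c 1)\<^sup>2 * c 2"
    by (simp_all add: power3_eq_cube power2_eq_square fps_mult_nth Wn numeral_eq_Suc
        atLeast0_atMost_Suc)
  have SW: "fps_nth (S oo W) 0 = 0" "fps_nth (S oo W) 1 = c 1" "fps_nth (S oo W) 2 = c 2"
      "fps_nth (S oo W) 3 = c 3 + c 1 ^ 3 / 6" "fps_nth (S oo W) 4 = c 4 + (c 1)\<^sup>2 * c 2 / 2"
    by (simp_all add: fps_compose_nth atLeast0AtMost atMost_nat_numeral atMost_Suc W3 Wn fact_numeral)
  \<comment> \<open>The summands for \<open>i = 0\<close> and \<open>i = n\<close> vanish, so (n -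
    1) \<open>a n\<close> is given by earlier coefficients.\<close>
  have coeff: "of_nat n * a n = a n + (\<Sum>i=0..n. a i * fps_nth (S oo W) (n - i))" if "0 < n" for n
    using arg_cong[OF ode, of "\<lambda>g. fps_nth g n"] that
    by (simp add: distrib_left fps_mult_nth[of F "S oo W"] Fn)
  note nth = SW SW(2)[simplified] atLeast0AtMost atMost_nat_numeral atMost_Suc algebra_simps
  have 2: "a 2 = c 1"
    using coeff[of 2] by (simp add: nth)
  have 3: "2 * a 3 = c 2 + c 1 * a 2"
    using coeff[of 3] by (simp add: nth)
  have 4: "3 * a 4 = c 3 + c 1 ^ 3 / 6 + c 2 * a 2 + c 1 * a 3"
    using coeff[of 4] by (simp add: nth)
  have 5: "4 * a 5 = c 4 + (c 1)\<^sup>2 * c 2 / 2 + (c 3 + c 1 ^ 3 / 6) * a 2 + c 2 * a 3 + c 1 * a 4"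
    using coeff[of 5] by (simp add: nth)
  have "hankel_3_1 f = - (c 3)\<^sup>2 / 9 + (c 2 - (c 1)\<^sup>2) * c 4 / 8 + c 1 * c 2 * c 3 / 6
      + c 1 ^ 3 * c 3 / 54 - c 2 ^ 3 / 16 - c 1 ^ 4 * c 2 / 72 - c 1 ^ 6 / 1296"
  proof -
    have a3: "a 3 = (c 2 + (c 1)\<^sup>2) / 2"
      using 3 by (simp add: 2 field_simps power2_eq_square)
    have a4: "a 4 = c 3 / 3 + c 1 * c 2 / 2 + 2 * c 1 ^ 3 / 9"
    proof -
      have "a 4 = (c 3 + c 1 ^ 3 / 6 + c 2 * a 2 + c 1 * a 3) / 3"
        unfolding 4[symmetric] by simp
      also have "\<dots> = c 3 / 3 + c 1 * c 2 / 2 + 2 * c 1 ^ 3 / 9"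
        unfolding 2 a3 by (simp add: field_simps eval_nat_numeral)
      finally show ?thesis .
    qed
    have a5: "a 5 = (c 4 + 4 / 3 * c 1 * c 3 + 3 / 2 * (c 1)\<^sup>2 * c 2 + (c 2)\<^sup>2 / 2
        + 7 / 18 * c 1 ^ 4) / 4"
    proof -
      have "a 5 = (c 4 + (c 1)\<^sup>2 * c 2 / 2 + (c 3 + c 1 ^ 3 / 6) * a 2 + c 2 * a 3 + c 1 * a 4) / 4"
        unfolding 5[symmetric] by simp
      also have "\<dots> = (c 4 + 4 / 3 * c 1 * c 3 + 3 / 2 * (c 1)\<^sup>2 * c 2 + (c 2)\<^sup>2 / 2
          + 7 / 18 * c 1 ^ 4) / 4"
        unfolding 2 a3 a4 by (simp add: field_simps eval_nat_numeral)
      finally show ?thesis .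
    qed
    show ?thesis
      unfolding hankel_3_1_def Let_def a_def[symmetric] 2 a3 a4 a5
      by (simp add: field_simps eval_nat_numeral)
  qed
  with \<omega> show thesis
    by (intro that) (simp_all add: c_def Let_def)
qed

section \<open>Estimate of the coefficient polynomial\<close>

lemma norm_hankel_polynomial_le:
  fixes c1 c2 c3 c4 :: complex
  assumes "(norm c1)\<^sup>2 + (norm c2)\<^sup>2 + (norm c3)\<^sup>2 + (norm c4)\<^sup>2 \<le> 1"
  shows "norm (- c3\<^sup>2 / 9 + (c2 - c1\<^sup>2) * c4 / 8 + c1 * c2 * c3 / 6 + c1 ^ 3 * c3 / 54
       - c2 ^ 3 / 16 - c1 ^ 4 * c2 / 72 - c1 ^ 6 / 1296) \<le> 1 / 4"
proof -
  define x y u w where "x = norm c1" "y = norm c2" "u = norm c3" "w = norm c4"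
  note defs = this
  have nonneg: "0 \<le> x" "0 \<le> y" "0 \<le> u" "0 \<le> w"
    by (simp_all add: defs)
  have bessel: "x\<^sup>2 + y\<^sup>2 + u\<^sup>2 + w\<^sup>2 \<le> 1"
    using assms by (simp add: defs)
  have "x\<^sup>2 \<le> 1" "y\<^sup>2 \<le> 1" "u\<^sup>2 \<le> 1"
    using bessel zero_le_power2[of x] zero_le_power2[of y] zero_le_power2[of u]
      zero_le_power2[of w] by linarith+
  then have le1: "x \<le> 1" "y \<le> 1" "u \<le> 1"
    by (simp_all add: abs_square_le_1)
  have amgm: "s * t \<le> (s\<^sup>2 + t\<^sup>2) / 2" for s t :: real
    using sum_squares_bound[of s t] by simp
  have "norm (- c3\<^sup>2 / 9 + (c2 - c1\<^sup>2) * c4 / 8 + c1 * c2 * c3 / 6 + c1 ^ 3 * c3 / 54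
       - c2 ^ 3 / 16 - c1 ^ 4 * c2 / 72 - c1 ^ 6 / 1296)
    \<le> u\<^sup>2 / 9 + (y + x\<^sup>2) * w / 8 + x * y * u / 6 + x ^ 3 * u / 54
       + y ^ 3 / 16 + x ^ 4 * y / 72 + x ^ 6 / 1296"
  proof -
    have "norm ((c2 - c1\<^sup>2) * c4 / 8) \<le> (y + x\<^sup>2) * w / 8"
      using norm_triangle_ineq4[of c2 "c1\<^sup>2"]
      by (auto simp: norm_mult norm_divide norm_power defs intro!: mult_right_mono)
    then show ?thesis
      by (intro norm_triangle_le norm_triangle_le_diff add_mono)
         (simp_all add: norm_mult norm_divide norm_power defs)
  qed
  \<comment> \<open>Every monomial has degree at least 2; surplus factors are at most 1 and are
    dropped until a quadratic form remains.\<close>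
  also have "\<dots> \<le> u\<^sup>2 / 9 + (y * w + x * w) / 8 + x * y / 6 + x * u / 54
       + y\<^sup>2 / 16 + x * y / 72 + x\<^sup>2 / 1296"
  proof -
    have pow: "s ^ Suc n \<le> s" if "0 \<le> s" "s \<le> 1" for s :: real and n
      using power_decreasing[of 1 "Suc n" s] that by simp
    have "x\<^sup>2 \<le> x" "x ^ 3 \<le> x" "x ^ 4 \<le> x"
      using pow[of x 1] pow[of x 2] pow[of x 3] nonneg le1 by (simp_all add: numeral_eq_Suc)
    moreover have "y ^ 3 \<le> y\<^sup>2" "x ^ 6 \<le> x\<^sup>2"
      using nonneg le1 by (simp_all add: power_decreasing)
    moreover have "x * y * u \<le> x * y"
      using nonneg le1 by (simp add: mult_left_le)
    moreover have "x\<^sup>2 * w \<le> x * w" "x ^ 3 * u \<le> x * u" "x ^ 4 * y \<le> x * y"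
      using calculation nonneg by (simp_all add: mult_right_mono)
    ultimately show ?thesis
      unfolding distrib_right by (intro add_mono divide_right_mono) simp_all
  qed
  \<comment> \<open>After splitting the mixed products by AM-GM, the largest coefficient is that of
    \<open>y\<^sup>2\<close>: 1/16 + 1/12 + 1/16 + 1/144 = 31/144 < 1/4.\<close>
  also have "\<dots> \<le> (x\<^sup>2 + y\<^sup>2 + u\<^sup>2 + w\<^sup>2) / 4"
    using amgm[of y w] amgm[of x w] amgm[of x y] amgm[of x u]
      zero_le_power2[of x] zero_le_power2[of y] zero_le_power2[of u] zero_le_power2[of w]
    by argo
  also have "\<dots> \<le> 1 / 4"
    using bessel by simp
  finally show ?thesis .
qed

theorem theorem8:
  fixes f :: "complex \<Rightarrow> complex"
  assumes "f \<in> G_sh"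
  shows "norm (hankel_3_1 f) \<le> 1 / 4"
proof -
  obtain \<omega> where \<omega>: "schwarz_function \<omega>" and eq:
    "hankel_3_1 f = (let c = taylor_coeff \<omega> in
       - (c 3)\<^sup>2 / 9 + (c 2 - (c 1)\<^sup>2) * c 4 / 8 + c 1 * c 2 * c 3 / 6 + c 1 ^ 3 * c 3 / 54
       - c 2 ^ 3 / 16 - c 1 ^ 4 * c 2 / 72 - c 1 ^ 6 / 1296)"
    using hankel_3_1_eq[OF assms] .
  have "(\<Sum>k\<le>4. (norm (taylor_coeff \<omega> k))\<^sup>2) \<le> 1"
    using \<omega> by (intro sum_taylor_coeff_le) (force simp: schwarz_function_def)+
  \<comment> \<open>The nonnegative term for \<open>k = 0\<close> is discarded.\<close>
  then have "(norm (taylor_coeff \<omega> 1))\<^sup>2 + (norm (taylor_coeff \<omega> 2))\<^sup>2 +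
      (norm (taylor_coeff \<omega> 3))\<^sup>2 + (norm (taylor_coeff \<omega> 4))\<^sup>2 \<le> 1"
    by (rule order_trans[rotated]) (simp add: atMost_nat_numeral)
  from norm_hankel_polynomial_le[OF this] show ?thesis
    unfolding eq Let_def .
qed

end
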